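(* Let $\alpha>0$ and $\gamma>0$, and let the characteristic function $f$ of the density $p$ satisfy $B(p;\alpha,\gamma)=\int e^{\gamma|t|^\alpha}|f(t)|\,dt<\infty$. Let $A(p)=\frac1{2\pi}\int|f(t)|\,dt$. Let $p_n=p_{n,h_n}$ be the sinc estimator with $$h_n=\Bigl\{\frac1\gamma\log(h_0n)\Bigr\}^{-1/\alpha},\qquad h_0>\frac1n.$$ Then $$\sup_{x\in\mathbb{R}}\mathrm{MSE}(p_n(x))\le\frac1n\Bigl\{\frac{2A(p)}{\pi\gamma^{1/\alpha}}(\log h_0+\log n)^{1/\alpha}+\frac{B^2(p;\alpha,\gamma)}{4\pi^2nh_0^2}\Bigr\}.$$
   Context: Let $X_1,\dots,X_n$ be i.i.d. real random variables with probability density $p$ and characteristic function $f(t)=\int e^{itx}p(x)\,dx$; as $f$ is integrable here, $p$ denotes the continuous version of the density, $p(x)=\frac1{2\pi}\int e^{-itx}f(t)\,dt$. The sinc kernel is $K(x)=\frac{\sin x}{\pi x}$ (with $K(0)=1/\pi$); the sinc estimator with bandwidth $h>0$ is $p_{n,h}(x)=\frac1{nh}\sum_{j=1}^nK\bigl((x-X_j)/h\bigr)$, equivalently $p_{n,h}(x)=\frac1{2\pi}\int_{-1/h}^{1/h}e^{-itx}f_n(t)\,dt$ with $f_n(t)=\frac1n\sum_{j=1}^ne^{itX_j}$. Define $\mathrm{MSE}(p_{n,h}(x))=\mathrm{E}\{p_{n,h}(x)-p(x)\}^2$, and $B^2(p;\alpha,\gamma)=(B(p;\alpha,\gamma))^2$.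 *)

theory Defs
  imports "HOL-Probability.Probability"
begin

definition sinc_kernel :: "real \<Rightarrow> real" where
  "sinc_kernel x = (if x = 0 then 1 / pi else sin x / (pi * x))"

definition sinc_estimator :: "(nat \<Rightarrow> 'a \<Rightarrow> real) \<Rightarrow> nat \<Rightarrow> real \<Rightarrow> real \<Rightarrow> 'a \<Rightarrow> real" where
  "sinc_estimator X n h x \<omega> =
     1 / (real n * h) * (\<Sum>j = 1..n. sinc_kernel ((x - X j \<omega>) / h))"

text \<open>The square is bounded and measurable in the sample point whenever the \<open>X j\<close> are random
  variables, so the Bochner integral below does not take a default value.\<close>

definition MSE :: "'a measure \<Rightarrow> (nat \<Rightarrow> 'a \<Rightarrow> real) \<Rightarrow> (real \<Rightarrow> real) \<Rightarrow> nat \<Rightarrow> real \<Rightarrow> real \<Rightarrow> real" where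
  "MSE M X p n h x = (LINT \<omega>|M. (sinc_estimator X n h x \<omega> - p x)\<^sup>2)"

definition char_of_density :: "(real \<Rightarrow> real) \<Rightarrow> real \<Rightarrow> complex" where
  "char_of_density p = char (density lborel (\<lambda>x. ennreal (p x)))"

definition A_const :: "(real \<Rightarrow> real) \<Rightarrow> real" where
  "A_const p = 1 / (2 * pi) * (LINT t|lborel. norm (char_of_density p t))"

definition B_integrand :: "(real \<Rightarrow> real) \<Rightarrow> real \<Rightarrow> real \<Rightarrow> real \<Rightarrow> real" where
  "B_integrand p \<alpha> \<gamma> t = exp (\<gamma> * \<bar>t\<bar> powr \<alpha>) * norm (char_of_density p t)"

definition B_const :: "(real \<Rightarrow> real) \<Rightarrow> real \<Rightarrow> real \<Rightarrow> real" where
  "B_const p \<alpha> \<gamma> = (LINT t|lborel. B_integrand p \<alpha> \<gamma> t)"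

end

theory Submission
  imports Defs
begin

text \<open>
  Put \<open>T = 1 / h\<close>. The estimator is the average of the i.i.d. variables
  \<open>T K(T (x - X\<^sub>j))\<close>, so its mean square error is at most their second moment divided by
  \<open>n\<close> plus the squared bias. Fourier inversion gives \<open>p \<le> A(p)\<close>, and
  \<open>K\<^sup>2 \<le> 2 / (\<pi>\<^sup>2 (1 + x\<^sup>2))\<close> gives \<open>\<integral> K\<^sup>2 \<le> 2 / \<pi>\<close>
  (the exact value is \<open>1 / \<pi>\<close>, but the factor 2 is allowed by the claim); hence the
  second moment is at most \<open>2 A(p) T / \<pi>\<close>. Since \<open>K\<close> is the Fourier transform of an
  indicator, the bias is the part of the inversion integral over \<open>|t| \<ge> T\<close>, where
  \<open>exp (\<gamma> |t|\<^sup>\<alpha>) \<ge> exp (\<gamma> T\<^sup>\<alpha>) = h\<^sub>0 n\<close>.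
\<close>

section \<open>The sinc kernel: bounds and Fourier representation\<close>

lemma borel_measurable_sinc_kernel [measurable]: "sinc_kernel \<in> borel_measurable borel"
  unfolding sinc_kernel_def[abs_def] by measurable

lemma abs_sinc_kernel_le: "\<bar>sinc_kernel x\<bar> \<le> 1 / pi"
proof (cases "x = 0")
  case False
  then show ?thesis
    using abs_sin_x_le_abs_x[of x] by (simp add: sinc_kernel_def abs_mult divide_simps)
qed (simp add: sinc_kernel_def)

text \<open>Adding sin^2 x \<le> x^2 and x^2 sin^2 x \<le> x^2 gives one bound that serves both near
  0 and at infinity. The majorant is a multiple of the Cauchy density, so its integral is
  known.\<close>

lemma sinc_kernel_square_le: "(sinc_kernel x)\<^sup>2 \<le> 2 / pi\<^sup>2 * inverse (1 + x\<^sup>2)"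
proof (cases "x = 0")
  case False
  have "(sin x)\<^sup>2 * (1 + x\<^sup>2) \<le> x\<^sup>2 + 1 * x\<^sup>2"
    unfolding distrib_left
    by (intro add_mono mult_mono) (use abs_sin_x_le_abs_x[of x] in \<open>simp_all add: abs_le_square_iff abs_square_le_1\<close>)
  moreover have "1 + x\<^sup>2 > 0" by (simp add: add_pos_nonneg)
  ultimately have "(sin x)\<^sup>2 / x\<^sup>2 \<le> 2 * inverse (1 + x\<^sup>2)"
    using False by (simp add: field_simps)
  from divide_right_mono[OF this, of "pi\<^sup>2"] show ?thesis
    using False by (simp add: sinc_kernel_def power_divide power_mult_distrib mult.commute)
qed (simp add: sinc_kernel_def power_divide divide_right_mono)

lemma
  shows integrable_sinc_kernel_square: "integrable lborel (\<lambda>x. (sinc_kernel x)\<^sup>2)"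
    and LBINT_sinc_kernel_square_le: "(LBINT x. (sinc_kernel x)\<^sup>2) \<le> 2 / pi"
proof -
  have int: "integrable lborel (\<lambda>x::real. inverse (1 + x\<^sup>2))"
    using integrable_inverse_1_plus_square by (simp add: set_integrable_def)
  have pi: "(LBINT x. inverse (1 + x\<^sup>2)) = pi"
    using LBINT_inverse_1_plus_square
    by (simp add: interval_lebesgue_integral_def set_lebesgue_integral_def)
  show 1: "integrable lborel (\<lambda>x. (sinc_kernel x)\<^sup>2)"
    by (rule Bochner_Integration.integrable_bound[OF integrable_mult_right[OF int, of "2 / pi\<^sup>2"]])
       (use sinc_kernel_square_le in auto)
  have "(LBINT x. (sinc_kernel x)\<^sup>2) \<le> (LBINT x. 2 / pi\<^sup>2 * inverse (1 + x\<^sup>2))"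
    by (intro integral_mono 1 integrable_mult_right int sinc_kernel_square_le)
  also have "\<dots> = 2 / pi"
    unfolding integral_mult_right_zero pi by (simp add: power2_eq_square)
  finally show "(LBINT x. (sinc_kernel x)\<^sup>2) \<le> 2 / pi" .
qed

text \<open>Integrating e^(-itu) over (-T, T) gives 2 sin(Tu)/u, or 2T at u = 0. This form allows
  the mean of the kernel to be compared with an inversion integral.\<close>

lemma sinc_kernel_fourier:
  assumes "T > 0"
  shows "complex_of_real (T * sinc_kernel (T * u)) =
    1 / (2 * pi) * (CLBINT t. indicator {-T<..<T} t *\<^sub>R iexp (-(t * u)))"
proof -
  have "(CLBINT t. indicator {-T<..<T} t *\<^sub>R iexp (-(t * u))) = (CLBINT t=-T..T. iexp (-(t * u)))"
    using assms by (simp add: interval_lebesgue_integral_def set_lebesgue_integral_def)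
  also have "\<dots> = 2 * pi * complex_of_real (T * sinc_kernel (T * u))"
  proof (cases "u = 0")
    case True
    have "(CLBINT t=-T..T. 1) = complex_of_real T - complex_of_real (-T)"
      by (subst interval_integral_FTC_finite[where F = complex_of_real])
         (auto intro!: derivative_eq_intros continuous_intros)
    with True show ?thesis by (simp add: sinc_kernel_def)
  next
    case False
    have "(CLBINT t=-T..T. iexp (-(t * u))) =
        \<i> / u * iexp (-(T * u)) - \<i> / u * iexp (-(- T * u))"
      by (subst interval_integral_FTC_finite[where F = "\<lambda>t. \<i> / u * iexp (-(t * u))"])
         (use False in \<open>auto intro!: derivative_eq_intros continuous_intros
            simp: has_vector_derivative_complex_iff Re_exp Im_exp Re_divide Im_divide power2_eq_square\<close>)
    also have "\<dots> = 2 * pi * complex_of_real (T * sinc_kernel (T * u))"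
      using False assms
      by (simp add: sinc_kernel_def complex_eq_iff Re_exp Im_exp Re_divide Im_divide field_simps power2_eq_square)
    finally show ?thesis .
  qed
  finally show ?thesis by simp
qed

text \<open>After an exchange of integrals, averaging e^(-it(x-y)) over y yields e^(-itx) times the
  characteristic function. The expected estimator is therefore the inversion integral cut off at
  frequency \<open>T\<close>.\<close>

lemma (in real_distribution) expectation_sinc_kernel:
  assumes "T > 0"
  shows "complex_of_real (LINT y|M. T * sinc_kernel (T * (x - y))) =
    1 / (2 * pi) * (CLBINT t. indicator {-T<..<T} t *\<^sub>R (iexp (-(t * x)) * char M t))"
proof -
  interpret P: pair_sigma_finite lborel M ..
  let ?f = "\<lambda>t y. indicator {-T<..<T} t *\<^sub>R iexp (-(t * (x - y)))"
  have "complex_of_real (LINT y|M. T * sinc_kernel (T * (x - y))) =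
      (CLINT y|M. 1 / (2 * pi) * (CLBINT t. ?f t y))"
    unfolding sinc_kernel_fourier[OF assms, symmetric] by simp
  also have "\<dots> = 1 / (2 * pi) * (CLINT y|M. (CLBINT t. ?f t y))"
    by simp
  also have "(CLINT y|M. (CLBINT t. ?f t y)) = (CLBINT t. (CLINT y|M. ?f t y))"
  \<comment> \<open>Fubini applies because the integrand has modulus at most 1 and vanishes outside
    (-T, T) times the sample space, a set of finite measure.\<close>
  proof (intro P.Fubini_integral integrableI_bounded_set [where B=1])
    show "emeasure (lborel \<Otimes>\<^sub>M M) ({- T<..<T} \<times> space M) < \<infinity>"
      using assms
      by (subst emeasure_pair_measure_Times)
         (auto simp: ennreal_mult_less_top not_less top_unique)
  qed (auto split: split_indicator split_indicator_asm)
  also have "\<dots> = (CLBINT t. indicator {-T<..<T} t *\<^sub>R (iexp (-(t * x)) * char M t))"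
  proof (intro Bochner_Integration.integral_cong refl)
    fix t
    have "(CLINT y|M. ?f t y) = (CLINT y|M. indicator {-T<..<T} t *\<^sub>R (iexp (-(t * x)) * iexp (t * y)))"
      by (intro Bochner_Integration.integral_cong) (auto simp: exp_add[symmetric] algebra_simps)
    then show "(CLINT y|M. ?f t y) = indicator {-T<..<T} t *\<^sub>R (iexp (-(t * x)) * char M t)"
      by (simp add: char_def)
  qed
  finally show ?thesis .
qed

section \<open>Second moments of independent sums\<close>

text \<open>In the expanded square each off-diagonal product factors by independence of the pair and
  has expectation 0, so only the diagonal survives.\<close>

lemma (in prob_space) second_moment_sum_indep:
  fixes Z :: "'i \<Rightarrow> 'a \<Rightarrow> real"
  assumes I: "finite I" and ind: "indep_vars (\<lambda>_. borel) Z I"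
    and sq: "\<And>i. i \<in> I \<Longrightarrow> integrable M (\<lambda>\<omega>. (Z i \<omega>)\<^sup>2)"
    and mean: "\<And>i. i \<in> I \<Longrightarrow> expectation (Z i) = 0"
  shows "expectation (\<lambda>\<omega>. (\<Sum>i\<in>I. Z i \<omega>)\<^sup>2) = (\<Sum>i\<in>I. expectation (\<lambda>\<omega>. (Z i \<omega>)\<^sup>2))"
proof -
  have rv: "random_variable borel (Z i)" if "i \<in> I" for i
    using ind that by (auto simp: indep_vars_def)
  have int: "integrable M (Z i)" if "i \<in> I" for i
    using square_integrable_imp_integrable[OF rv[OF that] sq[OF that]] .
  have prod: "integrable M (\<lambda>\<omega>. Z i \<omega> * Z j \<omega>) \<and>
      expectation (\<lambda>\<omega>. Z i \<omega> * Z j \<omega>) = (if i = j then expectation (\<lambda>\<omega>. (Z i \<omega>)\<^sup>2) else 0)"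
    if ij: "i \<in> I" "j \<in> I" for i j
  proof (cases "i = j")
    case True
    then show ?thesis using sq[OF ij(1)] by (simp add: power2_eq_square)
  next
    case False
    have ind': "indep_vars (\<lambda>_. borel) Z {i, j}"
      using ind ij by (rule_tac indep_vars_subset) auto
    show ?thesis
      using indep_vars_lebesgue_integral[OF _ ind'] indep_vars_integrable[OF _ ind'] int ij False mean
      by auto
  qed
  have "expectation (\<lambda>\<omega>. (\<Sum>i\<in>I. Z i \<omega>)\<^sup>2) = expectation (\<lambda>\<omega>. \<Sum>i\<in>I. \<Sum>j\<in>I. Z i \<omega> * Z j \<omega>)"
    by (simp add: power2_eq_square sum_product)
  also have "\<dots> = (\<Sum>i\<in>I. \<Sum>j\<in>I. expectation (\<lambda>\<omega>. Z i \<omega> * Z j \<omega>))"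
    using prod by (subst Bochner_Integration.integral_sum; simp)+
  also have "\<dots> = (\<Sum>i\<in>I. \<Sum>j\<in>I. if i = j then expectation (\<lambda>\<omega>. (Z i \<omega>)\<^sup>2) else 0)"
    using prod by (intro sum.cong refl) auto
  also have "\<dots> = (\<Sum>i\<in>I. expectation (\<lambda>\<omega>. (Z i \<omega>)\<^sup>2))"
    using I by simp
  finally show ?thesis .
qed

section \<open>Fourier inversion for an integrable characteristic function\<close>

text \<open>Levy's theorem gives the mass of an interval as a limit of integrals over (-n, n). When
  the characteristic function is integrable, dominated convergence turns this limit into a single
  integral over the line.\<close>

lemma (in real_distribution) Levy_Inversion_integrable:
  assumes "a \<le> b" and null: "measure M {a} = 0" "measure M {b} = 0"
    and int: "integrable lborel (char M)"
  shows "complex_of_real (measure M {a<..b}) =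
    1 / (2 * pi) * (CLBINT t. (iexp (-(t * a)) - iexp (-(t * b))) / (\<i> * t) * char M t)"
proof -
  let ?F = "\<lambda>t. (iexp (-(t * a)) - iexp (-(t * b))) / (\<i> * complex_of_real t) * char M t"
  \<comment> \<open>For t \<noteq> 0 the quotient is the integral of e^(-its) over s in [a, b],
    hence at most b - a in modulus. This supplies the majorant.\<close>
  have bound: "norm (?F t) \<le> (b - a) * norm (char M t)" if "t \<noteq> 0" for t
    using Levy_Inversion_aux2[of "-b" "-a" t] assms(1) that
    unfolding norm_mult by (intro mult_right_mono) auto
  have "(\<lambda>n. CLBINT t. indicator {-real n<..<real n} t *\<^sub>R ?F t) \<longlonglongrightarrow> (CLBINT t. ?F t)"
  proof (rule integral_dominated_convergence[where w = "\<lambda>t. (b - a) * norm (char M t)"])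
    show "integrable lborel (\<lambda>t. (b - a) * norm (char M t))"
      using int by simp
    show "AE t in lborel. (\<lambda>n. indicator {-real n<..<real n} t *\<^sub>R ?F t) \<longlonglongrightarrow> ?F t"
    proof (intro AE_I2 tendsto_eventually)
      fix t :: real
      obtain N :: nat where "\<bar>t\<bar> < N" using reals_Archimedean2 by blast
      then show "\<forall>\<^sub>F n in sequentially. indicator {-real n<..<real n} t *\<^sub>R ?F t = ?F t"
        by (intro eventually_sequentiallyI[of N]) (auto simp: indicator_def)
    qed
    have ne: "AE t::real in lborel. t \<noteq> 0" by (rule AE_lborel_singleton)
    show "AE t in lborel. norm (indicator {-real n<..<real n} t *\<^sub>R ?F t) \<le> (b - a) * norm (char M t)" for n
      using ne
    proof eventually_elim
      case (elim t)
      have "norm (indicator {-real n<..<real n} t *\<^sub>R ?F t) \<le> norm (?F t)"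
        by (simp add: indicator_def)
      with bound[OF elim] show ?case by linarith
    qed
  qed simp_all
  moreover have "(CLBINT t. indicator {-real n<..<real n} t *\<^sub>R ?F t) = (CLBINT t=-real n..real n. ?F t)" for n
    by (simp add: interval_lebesgue_integral_def set_lebesgue_integral_def)
  ultimately have "(\<lambda>n. 1 / (2 * pi) * (CLBINT t=-real n..real n. ?F t)) \<longlonglongrightarrow> 1 / (2 * pi) * (CLBINT t. ?F t)"
    by (intro tendsto_intros) simp_all
  moreover have "(\<lambda>n. 1 / (2 * pi) * (CLBINT t=-real n..real n. ?F t)) \<longlonglongrightarrow> complex_of_real (measure M {a<..b})"
    using Levy_Inversion[OF assms(1) null] by simp
  ultimately show ?thesis by (rule LIMSEQ_unique[rotated])
qed

text \<open>The interval formula on (x, b_n] is divided by b_n - x and b_n tends to x. The left side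
  tends to p(x) by the fundamental theorem of calculus, as p is continuous; the right side converges
  by dominated convergence.\<close>

lemma Levy_Inversion_density:
  fixes p :: "real \<Rightarrow> real"
  assumes "real_distribution (density lborel (\<lambda>x. ennreal (p x)))"
    and nn: "\<And>x. 0 \<le> p x" and cont: "continuous_on UNIV p"
    and int: "integrable lborel (char (density lborel (\<lambda>x. ennreal (p x))))"
  shows "complex_of_real (p x) =
    1 / (2 * pi) * (CLBINT t. iexp (-(t * x)) * char (density lborel (\<lambda>x. ennreal (p x))) t)"
proof -
  let ?M = "density lborel (\<lambda>x. ennreal (p x))"
  interpret real_distribution ?M by fact
  have p[measurable]: "p \<in> borel_measurable borel"
    using cont by (rule borel_measurable_continuous_onI)
  \<comment> \<open>The points lie strictly above \<open>x\<close>, so the quotients make sense, and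
    within [x, x+1], where the one-sided derivative of the integral of \<open>p\<close> is
    taken.\<close>
  define b where "b n = x + inverse (real (Suc n))" for n
  have b: "x < b n" "b n \<in> {x..x+1}" for n
    by (auto simp: b_def field_simps)
  have b_lim: "b \<longlonglongrightarrow> x"
    unfolding b_def[abs_def] by (rule LIMSEQ_inverse_real_of_nat_add)
  \<comment> \<open>Levy's formula asks for endpoints without mass; a law with a density has no
    atoms.\<close>
  have meas: "measure ?M {c} = 0" for c
    by (simp add: measure_def emeasure_density nn_integral_null_set[of "{c}"] nn_integral_indicator_singleton)
  have meas_int: "measure ?M {x<..c} = integral {x..c} p" for c
  proof -
    have ac: "set_integrable lborel {x..c} p"
      by (intro borel_integrable_atLeastAtMost' continuous_on_subset[OF cont]) simp
    have ne: "AE y in lborel. y \<noteq> x" by (rule AE_lborel_singleton)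
    have "measure ?M {x<..c} = (LINT y|?M. indicator {x<..c} y)"
      by simp
    also have "\<dots> = (LINT y|lborel. p y *\<^sub>R indicator {x<..c} y)"
      by (rule integral_density) (use nn in simp_all)
    also have "\<dots> = (LINT y:{x..c}|lborel. p y)"
      unfolding set_lebesgue_integral_def
    proof (rule integral_cong_AE)
      show "AE y in lborel. p y *\<^sub>R indicator {x<..c} y = indicator {x..c} y *\<^sub>R p y"
        using ne by eventually_elim (auto simp: indicator_def)
    qed simp_all
    also have "\<dots> = integral {x..c} p"
      by (rule set_borel_integral_eq_integral[OF ac])
    finally show ?thesis .
  qed
  have "(\<lambda>n. (integral {x..b n} p - integral {x..x} p) / (b n - x)) \<longlonglongrightarrow> p x"
  proof -
    have "((\<lambda>c. integral {x..c} p) has_real_derivative p x) (at x within {x..x+1})"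
      by (rule integral_has_real_derivative) (auto intro: continuous_on_subset[OF cont])
    then have "((\<lambda>c. (integral {x..c} p - integral {x..x} p) / (c - x)) \<longlongrightarrow> p x) (at x within {x..x+1})"
      by (simp add: has_field_derivative_iff)
    moreover have "filterlim b (at x within {x..x+1}) sequentially"
      using b b_lim by (auto simp: filterlim_at less_imp_neq[symmetric])
    ultimately show ?thesis by (rule filterlim_compose)
  qed
  then have "(\<lambda>n. complex_of_real (measure ?M {x<..b n} / (b n - x))) \<longlonglongrightarrow> complex_of_real (p x)"
    by (simp only: tendsto_of_real_iff meas_int) simp
  moreover
  let ?F = "\<lambda>n t. (iexp (-(t * x)) - iexp (-(t * b n))) / (\<i> * complex_of_real t) / complex_of_real (b n - x)"
  have ne: "AE t::real in lborel. t \<noteq> 0" by (rule AE_lborel_singleton)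
  have "(\<lambda>n. CLBINT t. ?F n t * char ?M t) \<longlonglongrightarrow> (CLBINT t. iexp (-(t * x)) * char ?M t)"
  \<comment> \<open>The quotient before division by b_n - x is at most b_n - x in modulus, so
    \<open>?F n t\<close> is at most 1 and the characteristic function itself dominates.\<close>
  proof (rule integral_dominated_convergence[where w = "\<lambda>t. norm (char ?M t)"])
    show "integrable lborel (\<lambda>t. norm (char ?M t))"
      using int by simp
    show "AE t in lborel. norm (?F n t * char ?M t) \<le> norm (char ?M t)" for n
      using ne
    proof eventually_elim
      case (elim t)
      have "norm (?F n t) = norm ((iexp (-(t * x)) - iexp (-(t * b n))) / (\<i> * t)) / (b n - x)"
        using b(1)[of n] by (simp only: norm_divide norm_of_real)
      also have "\<dots> \<le> 1"
        using Levy_Inversion_aux2[of "- b n" "-x" t] b(1)[of n] elim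
        by (simp add: divide_le_eq_1)
      finally have "norm (?F n t) \<le> 1" .
      then show ?case
        unfolding norm_mult by (rule mult_left_le_one_le[rotated 2]) simp_all
    qed
    show "AE t in lborel. (\<lambda>n. ?F n t * char ?M t) \<longlonglongrightarrow> iexp (-(t * x)) * char ?M t"
      using ne
    proof eventually_elim
      case (elim t)
      \<comment> \<open>Since -1/i = i, \<open>?F n t\<close> is i/t times the difference quotient
        of z -> e^(-itz) at x. Its limit is (i/t)(-it) e^(-itx) = e^(-itx).\<close>
      let ?e = "\<lambda>z. exp (- \<i> * t * z)"
      have "(?e has_field_derivative - \<i> * t * ?e x) (at (of_real x))"
        by (auto intro!: derivative_eq_intros)
      then have "((\<lambda>z. (?e z - ?e x) / (z - of_real x)) \<longlongrightarrow> - \<i> * t * ?e x) (at (of_real x))"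
        by (simp add: has_field_derivative_iff)
      moreover have "filterlim (\<lambda>n. complex_of_real (b n)) (at (of_real x)) sequentially"
        using b b_lim by (auto simp: filterlim_at less_imp_neq[symmetric] intro!: tendsto_of_real)
      ultimately have "(\<lambda>n. (?e (b n) - ?e x) / (complex_of_real (b n) - of_real x)) \<longlonglongrightarrow> - \<i> * t * ?e x"
        by (rule filterlim_compose)
      then have "(\<lambda>n. \<i> / t * ((?e (b n) - ?e x) / (complex_of_real (b n) - of_real x)) * char ?M t)
          \<longlonglongrightarrow> \<i> / t * (- \<i> * t * ?e x) * char ?M t"
        by (intro tendsto_intros)
      moreover have "\<i> / t * (- \<i> * t * ?e x) = iexp (-(t * x))"
        using elim by (simp add: mult.assoc)
      moreover have "\<i> / t * ((?e (b n) - ?e x) / (complex_of_real (b n) - of_real x)) = ?F n t" for n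
        using elim b(1)[of n] by (simp add: field_simps)
      ultimately show ?case by (simp only:)
    qed
  qed simp_all
  then have "(\<lambda>n. 1 / (2 * pi) * (CLBINT t. ?F n t * char ?M t)) \<longlonglongrightarrow>
      1 / (2 * pi) * (CLBINT t. iexp (-(t * x)) * char ?M t)"
    by (intro tendsto_intros)
  moreover have "1 / (2 * pi) * (CLBINT t. ?F n t * char ?M t) =
      complex_of_real (measure ?M {x<..b n} / (b n - x))" for n
  proof -
    have "(CLBINT t. ?F n t * char ?M t) = (CLBINT t.
        (iexp (-(t * x)) - iexp (-(t * b n))) / (\<i> * t) * char ?M t / complex_of_real (b n - x))"
      by (simp only: times_divide_eq_left)
    also have "\<dots> = (CLBINT t. (iexp (-(t * x)) - iexp (-(t * b n))) / (\<i> * t) * char ?M t) / complex_of_real (b n - x)"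
      by (rule integral_divide_zero)
    finally show ?thesis
      using Levy_Inversion_integrable[OF less_imp_le[OF b(1)[of n]] meas meas int]
      by (simp del: of_real_diff)
  qed
  ultimately show ?thesis
    by (simp only: LIMSEQ_unique)
qed

section \<open>Bias and variance of an average\<close>

text \<open>Centring at \<open>m\<close> splits the error into a fluctuation of mean 0 and the
  constant m - c, so the cross term vanishes. The variance of one term is its second moment minus
  m^2, hence at most \<open>v\<close>, and independence makes the variances add.\<close>

lemma (in prob_space) mean_square_error_average_le:
  fixes Y :: "'i \<Rightarrow> 'a \<Rightarrow> real"
  assumes I: "finite I" "I \<noteq> {}" and ind: "indep_vars (\<lambda>_. borel) Y I"
    and sq: "\<And>i. i \<in> I \<Longrightarrow> integrable M (\<lambda>\<omega>. (Y i \<omega>)\<^sup>2)"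
    and mean: "\<And>i. i \<in> I \<Longrightarrow> expectation (Y i) = m"
    and second: "\<And>i. i \<in> I \<Longrightarrow> expectation (\<lambda>\<omega>. (Y i \<omega>)\<^sup>2) \<le> v"
  shows "expectation (\<lambda>\<omega>. ((\<Sum>i\<in>I. Y i \<omega>) / card I - c)\<^sup>2) \<le> v / card I + (m - c)\<^sup>2"
proof -
  define Z where "Z i \<omega> = Y i \<omega> - m" for i \<omega>
  have rv: "random_variable borel (Y i)" if "i \<in> I" for i
    using ind that by (auto simp: indep_vars_def)
  have intY: "integrable M (Y i)" if "i \<in> I" for i
    using square_integrable_imp_integrable[OF rv[OF that] sq[OF that]] .
  have indZ: "indep_vars (\<lambda>_. borel) Z I"
    unfolding Z_def[abs_def] by (rule indep_vars_compose2[OF ind]) simp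
  have intZ: "integrable M (Z i)" if "i \<in> I" for i
    using intY[OF that] by (simp add: Z_def[abs_def])
  have sqZ: "integrable M (\<lambda>\<omega>. (Z i \<omega>)\<^sup>2)" if "i \<in> I" for i
    using intY[OF that] sq[OF that] by (simp add: Z_def power2_diff)
  have meanZ: "expectation (Z i) = 0" if "i \<in> I" for i
    using intY[OF that] mean[OF that] by (simp add: Z_def[abs_def] prob_space)
  have secondZ: "expectation (\<lambda>\<omega>. (Z i \<omega>)\<^sup>2) \<le> v" if "i \<in> I" for i
  proof -
    have "expectation (\<lambda>\<omega>. (Z i \<omega>)\<^sup>2) = expectation (\<lambda>\<omega>. (Y i \<omega>)\<^sup>2) - m\<^sup>2"
      using variance_eq[OF intY[OF that] sq[OF that]] by (simp add: Z_def mean[OF that])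
    then show ?thesis using second[OF that] zero_le_power2[of m] by linarith
  qed
  let ?S = "\<lambda>\<omega>. \<Sum>i\<in>I. Z i \<omega>"
  have card: "real (card I) > 0" using I by (simp add: card_gt_0_iff)
  have intS: "integrable M ?S" using intZ by simp
  \<comment> \<open>Each product is dominated by the sum of the two squares. Integrability of the
    squared sum is what permits splitting the expectation term by term later.\<close>
  have intS2: "integrable M (\<lambda>\<omega>. (?S \<omega>)\<^sup>2)"
  proof -
    have "integrable M (\<lambda>\<omega>. Z i \<omega> * Z j \<omega>)" if "i \<in> I" "j \<in> I" for i j
    proof (rule Bochner_Integration.integrable_bound)
      show "integrable M (\<lambda>\<omega>. (Z i \<omega>)\<^sup>2 + (Z j \<omega>)\<^sup>2)"
        using sqZ that by simp
      show "(\<lambda>\<omega>. Z i \<omega> * Z j \<omega>) \<in> borel_measurable M"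
        using intZ that by (intro borel_measurable_times borel_measurable_integrable)
      have "\<bar>a * b\<bar> \<le> a\<^sup>2 + b\<^sup>2" for a b :: real
        using sum_squares_bound[of "\<bar>a\<bar>" "\<bar>b\<bar>"] abs_ge_zero[of "a * b"]
        unfolding abs_mult power2_abs by linarith
      then show "AE \<omega> in M. norm (Z i \<omega> * Z j \<omega>) \<le> norm ((Z i \<omega>)\<^sup>2 + (Z j \<omega>)\<^sup>2)"
        by simp
    qed
    then show ?thesis by (simp add: power2_eq_square sum_product)
  qed
  have "expectation (\<lambda>\<omega>. ((\<Sum>i\<in>I. Y i \<omega>) / card I - c)\<^sup>2) =
      expectation (\<lambda>\<omega>. (?S \<omega>)\<^sup>2 / (card I)\<^sup>2 + 2 * (m - c) / card I * ?S \<omega> + (m - c)\<^sup>2)"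
  proof (intro Bochner_Integration.integral_cong refl)
    fix \<omega>
    have "(\<Sum>i\<in>I. Y i \<omega>) = ?S \<omega> + card I * m"
      by (simp add: Z_def sum_subtractf)
    then have eq: "(\<Sum>i\<in>I. Y i \<omega>) / card I - c = ?S \<omega> / card I + (m - c)"
      using card by (simp add: field_simps)
    show "((\<Sum>i\<in>I. Y i \<omega>) / card I - c)\<^sup>2 =
        (?S \<omega>)\<^sup>2 / (card I)\<^sup>2 + 2 * (m - c) / card I * ?S \<omega> + (m - c)\<^sup>2"
      unfolding eq power2_sum by (simp add: power_divide)
  qed
  also have "\<dots> = expectation (\<lambda>\<omega>. (?S \<omega>)\<^sup>2) / (card I)\<^sup>2 + 2 * (m - c) / card I * expectation ?S + (m - c)\<^sup>2"
    using intS intS2 by (simp add: prob_space)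
  also have "expectation ?S = 0"
    using intZ meanZ by simp
  also have "expectation (\<lambda>\<omega>. (?S \<omega>)\<^sup>2) = (\<Sum>i\<in>I. expectation (\<lambda>\<omega>. (Z i \<omega>)\<^sup>2))"
    by (rule second_moment_sum_indep[OF I(1) indZ sqZ meanZ])
  also have "(\<Sum>i\<in>I. expectation (\<lambda>\<omega>. (Z i \<omega>)\<^sup>2)) / (card I)\<^sup>2 \<le> (card I * v) / (card I)\<^sup>2"
    by (intro divide_right_mono sum_bounded_above secondZ) simp_all
  also have "(card I * v) / (card I)\<^sup>2 = v / card I"
    using card by (simp add: power2_eq_square)
  finally show ?thesis by simp
qed

section \<open>Bounds for the density, the bias and the second moment\<close>

text \<open>Absolute values are taken inside the inversion integral, where e^(-itx) has modulus
  1.\<close>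

lemma density_le_A_const:
  assumes "real_distribution (density lborel (\<lambda>x. ennreal (p x)))"
    and "\<And>x. 0 \<le> p x" and "continuous_on UNIV p"
    and "integrable lborel (char_of_density p)"
  shows "p x \<le> A_const p"
proof -
  have "p x = norm (complex_of_real (p x))"
    using assms(2)[of x] by simp
  also have "\<dots> = 1 / (2 * pi) * norm (CLBINT t. iexp (-(t * x)) * char_of_density p t)"
    using Levy_Inversion_density[OF assms(1-3), of x] assms(4)
    by (simp add: char_of_density_def norm_divide)
  also have "\<dots> \<le> 1 / (2 * pi) * (LBINT t. norm (iexp (-(t * x)) * char_of_density p t))"
    by (intro mult_left_mono integral_norm_bound) simp
  also have "\<dots> = A_const p"
    by (simp add: A_const_def norm_mult)
  finally show ?thesis .
qed

text \<open>The mean and \<open>p x\<close> are the truncated and the full inversion integral, so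
  only frequencies |t| \<ge> T contribute.\<close>

lemma sinc_bias_le:
  assumes "real_distribution (density lborel (\<lambda>x. ennreal (p x)))"
    and "\<And>x. 0 \<le> p x" and "continuous_on UNIV p"
    and int: "integrable lborel (char_of_density p)"
    and B: "integrable lborel (B_integrand p \<alpha> \<gamma>)" and "\<alpha> > 0" "\<gamma> > 0" "T > 0"
  shows "\<bar>(LINT y|density lborel (\<lambda>x. ennreal (p x)). T * sinc_kernel (T * (x - y))) - p x\<bar>
    \<le> exp (- (\<gamma> * T powr \<alpha>)) * B_const p \<alpha> \<gamma> / (2 * pi)"
proof -
  let ?D = "density lborel (\<lambda>x. ennreal (p x))"
  interpret real_distribution ?D by fact
  have f[measurable]: "char_of_density p \<in> borel_measurable borel"
    using int by auto
  let ?g = "\<lambda>t. iexp (-(t * x)) * char_of_density p t"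
  have g: "integrable lborel ?g"
    by (rule Bochner_Integration.integrable_bound[OF int]) (simp_all add: norm_mult)
  have gT: "integrable lborel (\<lambda>t. indicator {-T<..<T} t *\<^sub>R ?g t)"
    by (rule integrable_mult_indicator[OF _ g]) simp
  let ?m = "LINT y|?D. T * sinc_kernel (T * (x - y))"
  have "complex_of_real (?m - p x) = 1 / (2 * pi) *
      ((CLBINT t. indicator {-T<..<T} t *\<^sub>R ?g t) - (CLBINT t. ?g t))"
    unfolding of_real_diff expectation_sinc_kernel[OF \<open>T > 0\<close>]
    using Levy_Inversion_density[OF assms(1-3), of x] int
    by (simp add: char_of_density_def right_diff_distrib diff_divide_distrib)
  also have "\<dots> = 1 / (2 * pi) * (CLBINT t. indicator {-T<..<T} t *\<^sub>R ?g t - ?g t)"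
    using g gT by simp
  finally have bias: "\<bar>?m - p x\<bar> = 1 / (2 * pi) * norm (CLBINT t. indicator {-T<..<T} t *\<^sub>R ?g t - ?g t)"
    by (simp only: norm_of_real[symmetric, where 'a = complex]) (simp add: norm_mult norm_divide del: of_real_diff)
  have "norm (CLBINT t. indicator {-T<..<T} t *\<^sub>R ?g t - ?g t) \<le>
      (LBINT t. norm (indicator {-T<..<T} t *\<^sub>R ?g t - ?g t))"
    by (rule integral_norm_bound)
  also have "\<dots> \<le> (LBINT t. exp (- (\<gamma> * T powr \<alpha>)) * B_integrand p \<alpha> \<gamma> t)"
  proof (rule integral_mono)
    fix t
    show "norm (indicator {-T<..<T} t *\<^sub>R ?g t - ?g t) \<le> exp (- (\<gamma> * T powr \<alpha>)) * B_integrand p \<alpha> \<gamma> t"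
    \<comment> \<open>Inside the window the difference is 0 and the majorant is nonnegative.
      Outside, the two exponentials have product at least 1.\<close>
    proof (cases "t \<in> {-T<..<T}")
      case True
      then show ?thesis by (simp add: B_integrand_def)
    next
      case False
      then have "T powr \<alpha> \<le> \<bar>t\<bar> powr \<alpha>"
        using assms(6-8) by (intro powr_mono2) auto
      then have "1 \<le> exp (- (\<gamma> * T powr \<alpha>)) * exp (\<gamma> * \<bar>t\<bar> powr \<alpha>)"
        using \<open>\<gamma> > 0\<close> by (simp add: exp_add[symmetric])
      then have "norm (char_of_density p t) \<le>
          (exp (- (\<gamma> * T powr \<alpha>)) * exp (\<gamma> * \<bar>t\<bar> powr \<alpha>)) * norm (char_of_density p t)"
        using mult_right_mono[of 1 _ "norm (char_of_density p t)"] by simp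
      then show ?thesis
        using False by (simp add: B_integrand_def norm_mult mult.assoc)
    qed
  qed (use g gT B in simp_all)
  also have "\<dots> = exp (- (\<gamma> * T powr \<alpha>)) * B_const p \<alpha> \<gamma>"
    by (simp add: B_const_def)
  finally show ?thesis
    unfolding bias by (simp add: divide_right_mono)
qed

text \<open>Replacing \<open>p\<close> by its bound \<open>a\<close> leaves a Lebesgue integral with
  prefactor a T^2. The substitution u = T(x - y) consumes one factor \<open>T\<close>, which makes
  the bound linear in \<open>T\<close>.\<close>

lemma sinc_second_moment_le:
  assumes nn: "\<And>x. 0 \<le> p x" and "p \<in> borel_measurable borel" and le: "\<And>x. p x \<le> a" and "T > 0"
  shows "(LINT y|density lborel (\<lambda>x. ennreal (p x)). (T * sinc_kernel (T * (x - y)))\<^sup>2) \<le> 2 * a * T / pi"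
proof -
  have [measurable]: "p \<in> borel_measurable borel" by fact
  let ?K = "\<lambda>y. (sinc_kernel (T * (x - y)))\<^sup>2"
  have a: "0 \<le> a" using nn[of 0] le[of 0] by linarith
  \<comment> \<open>The argument is written as an affine function of \<open>y\<close> with slope -T;
    the change of variables then has Jacobian |-T| = T.\<close>
  have eq: "(sinc_kernel (T * x + (- T) * y))\<^sup>2 = ?K y" for y
    by (simp add: algebra_simps)
  have intK: "integrable lborel ?K"
    using lborel_integrable_real_affine[OF integrable_sinc_kernel_square, of "-T" "T * x"] \<open>T > 0\<close>
    unfolding eq by simp
  have K: "T * (LBINT y. ?K y) \<le> 2 / pi"
    using lborel_integral_real_affine[of "-T" "\<lambda>y. (sinc_kernel y)\<^sup>2" "T * x"] \<open>T > 0\<close>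
      LBINT_sinc_kernel_square_le
    unfolding eq by simp
  have "(LINT y|density lborel (\<lambda>x. ennreal (p x)). (T * sinc_kernel (T * (x - y)))\<^sup>2) =
      (LBINT y. p y *\<^sub>R (T * sinc_kernel (T * (x - y)))\<^sup>2)"
    by (rule integral_density) (use nn in simp_all)
  also have "\<dots> \<le> (LBINT y. a * T\<^sup>2 * ?K y)"
  proof (rule integral_mono)
    show "integrable lborel (\<lambda>y. p y *\<^sub>R (T * sinc_kernel (T * (x - y)))\<^sup>2)"
      by (rule Bochner_Integration.integrable_bound[OF integrable_mult_right[OF intK, of "a * T\<^sup>2"]])
         (use nn le in \<open>auto simp: abs_mult power_mult_distrib a mult.assoc intro!: mult_right_mono\<close>)
  qed (use nn le intK in \<open>auto simp: power_mult_distrib mult.assoc intro!: mult_right_mono\<close>)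
  also have "\<dots> = a * T * (T * (LBINT y. ?K y))"
    by (simp add: power2_eq_square)
  also have "\<dots> \<le> a * T * (2 / pi)"
    using a \<open>T > 0\<close> by (intro mult_left_mono K) simp
  finally show ?thesis by (simp add: mult_ac)
qed

section \<open>The bound for the chosen bandwidth\<close>

theorem theorem10:
  fixes M :: "'a measure" and X :: "nat \<Rightarrow> 'a \<Rightarrow> real" and p :: "real \<Rightarrow> real"
    and n :: nat and \<alpha> \<gamma> h\<^sub>0 h :: real
  assumes "prob_space M"
    and "n \<ge> 1"
    and "prob_space.indep_vars M (\<lambda>_. borel) X {1..n}"
    and "\<And>j. j \<in> {1..n} \<Longrightarrow> distributed M lborel (X j) (\<lambda>x. ennreal (p x))"
    and "\<And>x. 0 \<le> p x"
    and "continuous_on UNIV p"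
    and "\<alpha> > 0" and "\<gamma> > 0"
    and "integrable lborel (B_integrand p \<alpha> \<gamma>)"
    and "h\<^sub>0 > 1 / real n"
    and "h = (1 / \<gamma> * ln (h\<^sub>0 * real n)) powr (- 1 / \<alpha>)"
  shows "(SUP x. ereal (MSE M X p n h x)) \<le>
    ereal (1 / real n *
      (2 * A_const p / (pi * \<gamma> powr (1 / \<alpha>)) * (ln h\<^sub>0 + ln (real n)) powr (1 / \<alpha>)
        + (B_const p \<alpha> \<gamma>)\<^sup>2 / (4 * pi\<^sup>2 * real n * h\<^sub>0\<^sup>2)))"
\<comment> \<open>In \<open>ereal\<close> every supremum exists, so a bound at each single
  \<open>x\<close> suffices.\<close>
proof (rule SUP_least)
  fix x :: real
  interpret prob_space M by fact
  let ?D = "density lborel (\<lambda>x. ennreal (p x))"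
  let ?L = "ln (h\<^sub>0 * real n)"
  define T where "T = 1 / h"
  \<comment> \<open>As n \<ge> 1, the condition on \<open>h\<^sub>0\<close> says that the logarithm
    \<open>?L\<close> is positive; the powers below then have a positive base and T > 0.\<close>
  have h0n: "h\<^sub>0 * real n > 1"
    using assms(2,10) by (simp add: field_simps)
  have h0: "h\<^sub>0 > 0"
    using assms(10) by (rule le_less_trans[rotated]) simp
  have L: "?L > 0"
    using h0n by (rule ln_gt_zero)
  have T: "T = (?L / \<gamma>) powr (1 / \<alpha>)"
    by (simp add: T_def assms(11) powr_minus_divide)
  have Tpos: "T > 0" using L \<open>\<gamma> > 0\<close> by (simp add: T)
  have rvX: "random_variable borel (X j)" if "j \<in> {1..n}" for j
    using distributed_measurable[OF assms(4)[OF that]] by simp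
  have distr: "distr M borel (X j) = ?D" if "j \<in> {1..n}" for j
    using distributed_distr_eq_density[OF assms(4)[OF that]] by (simp cong: distr_cong)
  \<comment> \<open>Since n \<ge> 1, the measure with density \<open>p\<close> is the law of
    \<open>X 1\<close>, hence a probability measure.\<close>
  have D: "real_distribution ?D"
  proof -
    have "prob_space ?D"
      using distr[of 1] rvX[of 1] prob_space_distr[of "X 1" borel] assms(2) by simp
    then show ?thesis
      by (simp add: real_distribution_def real_distribution_axioms_def)
  qed
  then interpret D: real_distribution ?D .
  \<comment> \<open>The weight exp(\<gamma> |t|^\<alpha>) is at least 1, so finiteness of B(p;
    \<alpha>, \<gamma>) makes the characteristic function integrable.\<close>
  have intf: "integrable lborel (char_of_density p)"
  proof (rule Bochner_Integration.integrable_bound[OF assms(9)])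
    show "char_of_density p \<in> borel_measurable lborel"
      by (simp add: char_of_density_def)
    have "norm (char_of_density p t) \<le> norm (B_integrand p \<alpha> \<gamma> t)" for t
      using \<open>\<gamma> > 0\<close> by (simp add: B_integrand_def mult_le_cancel_right1)
    then show "AE t in lborel. norm (char_of_density p t) \<le> norm (B_integrand p \<alpha> \<gamma> t)"
      by simp
  qed
  define Y where "Y j \<omega> = T * sinc_kernel (T * (x - X j \<omega>))" for j \<omega>
  define m where "m = (LINT y|?D. T * sinc_kernel (T * (x - y)))"
  \<comment> \<open>With T = 1/h the j-th summand K((x - X_j)/h)/(nh) is Y_j/n, so the estimator is
    a plain average.\<close>
  have est: "sinc_estimator X n h x \<omega> = (\<Sum>j=1..n. Y j \<omega>) / card {1..n}" for \<omega>
    by (simp add: sinc_estimator_def Y_def T_def sum_distrib_left sum_divide_distrib mult.commute)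
  have ind: "indep_vars (\<lambda>_. borel) Y {1..n}"
    unfolding Y_def[abs_def] by (rule indep_vars_compose2[OF assms(3)]) simp
  have bound: "\<bar>Y j \<omega>\<bar> \<le> T / pi" for j \<omega>
    using mult_left_mono[OF abs_sinc_kernel_le, of T] Tpos by (simp add: Y_def abs_mult)
  have sq: "integrable M (\<lambda>\<omega>. (Y j \<omega>)\<^sup>2)" if "j \<in> {1..n}" for j
  proof (rule integrable_const_bound[of _ "(T / pi)\<^sup>2"])
    show "AE \<omega> in M. norm ((Y j \<omega>)\<^sup>2) \<le> (T / pi)\<^sup>2"
      using power_mono[OF bound abs_ge_zero, of j _ 2] by simp
    show "(\<lambda>\<omega>. (Y j \<omega>)\<^sup>2) \<in> borel_measurable M"
      using rvX[OF that] unfolding Y_def by measurable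
  qed
  have mean: "expectation (Y j) = m" if "j \<in> {1..n}" for j
    unfolding m_def distr[OF that, symmetric] Y_def[abs_def]
    using rvX[OF that] by (subst integral_distr) simp_all
  have second: "expectation (\<lambda>\<omega>. (Y j \<omega>)\<^sup>2) \<le> 2 * A_const p * T / pi" if "j \<in> {1..n}" for j
  proof -
    have "expectation (\<lambda>\<omega>. (Y j \<omega>)\<^sup>2) = (LINT y|?D. (T * sinc_kernel (T * (x - y)))\<^sup>2)"
      unfolding distr[OF that, symmetric] Y_def
      using rvX[OF that] by (subst integral_distr) simp_all
    also have "\<dots> \<le> 2 * A_const p * T / pi"
      by (rule sinc_second_moment_le[OF assms(5) _ density_le_A_const[OF D assms(5,6) intf] Tpos])
         (rule borel_measurable_continuous_onI[OF assms(6)])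
    finally show ?thesis .
  qed
  have "MSE M X p n h x \<le> 2 * A_const p * T / pi / card {1..n} + (m - p x)\<^sup>2"
    unfolding MSE_def est
    by (rule mean_square_error_average_le[OF _ _ ind sq mean second]) (use assms(2) in simp_all)
  also have "(m - p x)\<^sup>2 \<le> (B_const p \<alpha> \<gamma> / (h\<^sub>0 * n) / (2 * pi))\<^sup>2"
  proof -
    \<comment> \<open>This is where the choice of bandwidth enters: it makes the decay factor in the
      bias exactly 1/(h_0 n), so the squared bias is of order 1/n^2.\<close>
    have "\<gamma> * T powr \<alpha> = ?L"
      using L \<open>\<gamma> > 0\<close> \<open>\<alpha> > 0\<close> by (simp add: T powr_powr)
    then have "exp (- (\<gamma> * T powr \<alpha>)) = 1 / (h\<^sub>0 * n)"
      using h0n by (simp add: exp_minus inverse_eq_divide)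
    then have "\<bar>m - p x\<bar> \<le> B_const p \<alpha> \<gamma> / (h\<^sub>0 * n) / (2 * pi)"
      using sinc_bias_le[OF D assms(5,6) intf assms(9,7,8) Tpos, of x] by (simp add: m_def)
    from power_mono[OF this abs_ge_zero, of 2] show ?thesis by simp
  qed
  also have "2 * A_const p * T / pi / card {1..n} + (B_const p \<alpha> \<gamma> / (h\<^sub>0 * n) / (2 * pi))\<^sup>2 =
     1 / real n *
      (2 * A_const p / (pi * \<gamma> powr (1 / \<alpha>)) * (ln h\<^sub>0 + ln (real n)) powr (1 / \<alpha>)
        + (B_const p \<alpha> \<gamma>)\<^sup>2 / (4 * pi\<^sup>2 * real n * h\<^sub>0\<^sup>2))"
  proof -
    \<comment> \<open>The logarithm of the product and the power of the quotient are split to reach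
      the stated form of the variance term.\<close>
    have "T = (ln h\<^sub>0 + ln (real n)) powr (1 / \<alpha>) / \<gamma> powr (1 / \<alpha>)"
      using L \<open>\<gamma> > 0\<close> h0 assms(2) by (simp add: T powr_divide ln_mult)
    then show ?thesis
      using assms(2) h0 by (simp add: power_divide power_mult_distrib field_simps power2_eq_square)
  qed
  finally show "ereal (MSE M X p n h x) \<le> ereal (1 / real n *
      (2 * A_const p / (pi * \<gamma> powr (1 / \<alpha>)) * (ln h\<^sub>0 + ln (real n)) powr (1 / \<alpha>)
        + (B_const p \<alpha> \<gamma>)\<^sup>2 / (4 * pi\<^sup>2 * real n * h\<^sub>0\<^sup>2)))"
    by simp
qed

end
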